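(* Let $X$ be a real Banach space and let $\mathcal K\subset X$ be a norming set for $X^*$. Then the linear span $\operatorname{span}(\mathcal K)$ is dense in $X$.
   Context: A bounded set $\mathcal K\subset X$ is a norming set for the dual space $X^*$ if there exists a constant $C>0$ such that $\|\phi\|_*\le C\sup_{z\in\mathcal K}|\langle\phi,z\rangle|$ for all $\phi\in X^*$, where $\|\cdot\|_*$ is the norm of $X^*$ and $\langle\cdot,\cdot\rangle$ the duality pairing. *)

theory Defs
  imports "HOL-Analysis.Analysis"
begin

(* The dual space X* is the type of bounded linear functionals with the operator norm.
   The supremum is taken in [0, \<infinity>], so that it equals 0 for K = {};
   boundedness of K makes it finite. (On type real, Sup {} would be unspecified.) *)
definition norming_set :: "'a::real_normed_vector set \<Rightarrow> bool" where
  "norming_set K \<longleftrightarrow> bounded K \<and>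
     (\<exists>C::real. C > 0 \<and>
        (\<forall>\<phi> :: 'a \<Rightarrow>\<^sub>L real.
           ennreal (norm \<phi>) \<le> ennreal C * (SUP z\<in>K. ennreal \<bar>blinfun_apply \<phi> z\<bar>)))"

end

(* If span K is not dense, Hahn-Banach for the sublinear functional "distance to span K" yields a
   nonzero bounded functional vanishing on K, contradicting the norming inequality. Hahn-Banach
   is obtained from the fact that a minimal sublinear functional is linear: lowering q to
   x |-> inf {q (x + t y) - t q y | t >= 0} gives again a sublinear functional, whose value at -y
   is at most -q y. The same lowering, applied once at the start, fixes the value at a given
   point. *)
theory Submission
  imports Defs
begin

section \<open>Sublinear functionals and their lowering along a vector\<close>

definition sublinear :: "('a::real_vector \<Rightarrow> real) \<Rightarrow> bool" where
  "sublinear q \<longleftrightarrow> (\<forall>x y. q (x + y) \<le> q x + q y) \<and> (\<forall>c x. 0 \<le> c \<longrightarrow> q (c *\<^sub>R x) \<le> c * q x)"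

lemma sublinear_add: "sublinear q \<Longrightarrow> q (x + y) \<le> q x + q y"
  and sublinear_scale_le: "sublinear q \<Longrightarrow> 0 \<le> c \<Longrightarrow> q (c *\<^sub>R x) \<le> c * q x"
  by (auto simp: sublinear_def)

lemma sublinear_zero:
  assumes "sublinear q"
  shows "q 0 = 0"
  using sublinear_add[OF assms, of 0 0] sublinear_scale_le[OF assms, of 0 0] by simp

text \<open>The definition asks only for \<open><=\<close>, which is all that has to be checked for
  infima. For positive \<open>c\<close>, applying it with factor \<open>1 / c\<close> to
  \<open>c *\<^sub>R x\<close> gives the reverse inequality.\<close>

lemma sublinear_scale:
  assumes q: "sublinear q" and c: "0 \<le> c"
  shows "q (c *\<^sub>R x) = c * q x"
proof (cases "c = 0")
  case True
  then show ?thesis using sublinear_zero[OF q] by simp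
next
  case False
  with c have c': "c > 0" by simp
  have "q ((1 / c) *\<^sub>R (c *\<^sub>R x)) \<le> (1 / c) * q (c *\<^sub>R x)"
    using c by (intro sublinear_scale_le[OF q]) simp
  with c' have "c * q x \<le> q (c *\<^sub>R x)"
    by (simp add: field_simps)
  with sublinear_scale_le[OF q c, of x] show ?thesis by simp
qed

lemma sublinear_neg_le:
  assumes "sublinear q"
  shows "- q (- x) \<le> q x"
  using sublinear_add[OF assms, of x "- x"] sublinear_zero[OF assms] by simp

text \<open>Infima are taken one at a time: over \<open>t\<close> with \<open>s\<close> fixed, then
  over \<open>s\<close>. This transfers subadditivity to each infimum below:
  \<open>lower_at\<close>, the infimum of a chain, and \<open>infdist\<close>.\<close>

lemma le_cINF_add_cINF:
  fixes f :: "'a \<Rightarrow> real" and g :: "'b \<Rightarrow> real"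
  assumes "A \<noteq> {}" "B \<noteq> {}" and le: "\<And>s t. s \<in> A \<Longrightarrow> t \<in> B \<Longrightarrow> m \<le> f s + g t"
  shows "m \<le> (INF s\<in>A. f s) + (INF t\<in>B. g t)"
proof -
  have "m - f s \<le> (INF t\<in>B. g t)" if "s \<in> A" for s
  proof (rule cINF_greatest[OF assms(2)])
    fix t assume "t \<in> B"
    from le[OF that this] show "m - f s \<le> g t" by simp
  qed
  then have "m - (INF t\<in>B. g t) \<le> (INF s\<in>A. f s)"
    by (intro cINF_greatest[OF assms(1)]) (simp add: algebra_simps)
  then show ?thesis by simp
qed

lemma le_mult_cINF:
  fixes f :: "'a \<Rightarrow> real"
  assumes "A \<noteq> {}" "0 \<le> c" and le: "\<And>s. s \<in> A \<Longrightarrow> m \<le> c * f s"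
  shows "m \<le> c * (INF s\<in>A. f s)"
proof (cases "c = 0")
  case True
  with assms show ?thesis by auto
next
  case False
  with \<open>0 \<le> c\<close> have c: "c > 0" by simp
  have "m / c \<le> (INF s\<in>A. f s)"
    using le c by (intro cINF_greatest[OF assms(1)]) (simp add: field_simps)
  with c show ?thesis by (simp add: field_simps)
qed

text \<open>For sublinear \<open>q\<close> this is the largest sublinear \<open>r\<close> below
  \<open>q\<close> with \<open>r (- y) <= - q y\<close>: any such \<open>r\<close> satisfies
  \<open>r x <= r (x + t *\<^sub>R y) + t * r (- y) <= q (x + t *\<^sub>R y) - t * q
  y\<close>.\<close>

definition lower_at :: "('a::real_vector \<Rightarrow> real) \<Rightarrow> 'a \<Rightarrow> 'a \<Rightarrow> real" where
  "lower_at q y x = (INF t\<in>{0..}. q (x + t *\<^sub>R y) - t * q y)"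

lemma lower_at_le_term:
  assumes q: "sublinear q" and "0 \<le> t"
  shows "lower_at q y x \<le> q (x + t *\<^sub>R y) - t * q y"
  unfolding lower_at_def
proof (rule cINF_lower)
  \<comment> \<open>Writing \<open>s *\<^sub>R y\<close> as
    \<open>(x + s *\<^sub>R y) + (- x)\<close> gives a lower bound independent of \<open>s\<close>,
    so the real-valued infimum is a genuine one.\<close>
  have "- q (- x) \<le> q (x + s *\<^sub>R y) - s * q y" if "0 \<le> s" for s
    using sublinear_add[OF q, of "x + s *\<^sub>R y" "- x"] sublinear_scale[OF q that, of y] by simp
  then show "bdd_below ((\<lambda>t. q (x + t *\<^sub>R y) - t * q y) ` {0..})"
    by (intro bdd_belowI2[where m = "- q (- x)"]) simp
qed (use assms in simp)

lemma lower_at_le: "sublinear q \<Longrightarrow> lower_at q y x \<le> q x"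
  using lower_at_le_term[of q 0 y x] by simp

lemma lower_at_neg: "sublinear q \<Longrightarrow> lower_at q y (- y) \<le> - q y"
  using lower_at_le_term[of q 1 y "- y"] sublinear_zero[of q] by simp

lemma sublinear_lower_at:
  assumes q: "sublinear q"
  shows "sublinear (lower_at q y)"
  unfolding sublinear_def
proof (intro conjI allI impI)
  fix x x'
  show "lower_at q y (x + x') \<le> lower_at q y x + lower_at q y x'"
    unfolding lower_at_def[of q y x] lower_at_def[of q y x']
  proof (rule le_cINF_add_cINF)
    fix s t :: real
    assume st: "s \<in> {0..}" "t \<in> {0..}"
    \<comment> \<open>The parameters add: the terms for \<open>x\<close> at \<open>s\<close> and for
      \<open>x'\<close> at \<open>t\<close> together dominate the term for \<open>x + x'\<close> at
      \<open>s + t\<close>.\<close>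
    then have "lower_at q y (x + x') \<le> q (x + x' + (s + t) *\<^sub>R y) - (s + t) * q y"
      by (intro lower_at_le_term[OF q]) simp
    moreover have "x + x' + (s + t) *\<^sub>R y = (x + s *\<^sub>R y) + (x' + t *\<^sub>R y)"
      by (simp add: algebra_simps)
    ultimately show "lower_at q y (x + x')
        \<le> (q (x + s *\<^sub>R y) - s * q y) + (q (x' + t *\<^sub>R y) - t * q y)"
      using sublinear_add[OF q, of "x + s *\<^sub>R y" "x' + t *\<^sub>R y"] by (simp add: algebra_simps)
  qed auto
next
  fix c :: real and x
  assume c: "0 \<le> c"
  show "lower_at q y (c *\<^sub>R x) \<le> c * lower_at q y x"
    unfolding lower_at_def[of q y x]
  proof (rule le_mult_cINF[OF _ c])
    fix t :: real
    assume "t \<in> {0..}"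
    with c have "lower_at q y (c *\<^sub>R x) \<le> q (c *\<^sub>R x + (c * t) *\<^sub>R y) - (c * t) * q y"
      by (intro lower_at_le_term[OF q]) simp
    then show "lower_at q y (c *\<^sub>R x) \<le> c * (q (x + t *\<^sub>R y) - t * q y)"
      using sublinear_scale[OF q c, of "x + t *\<^sub>R y"] by (simp add: algebra_simps)
  qed auto
qed

section \<open>From minimal sublinear functionals to Hahn-Banach\<close>

lemma sublinear_odd_imp_linear:
  assumes q: "sublinear q" and odd: "\<And>x. q (- x) = - q x"
  shows "linear q"
proof (rule linearI)
  fix x y
  show "q (x + y) = q x + q y"
    \<comment> \<open>Subadditivity at the negated vectors, read through oddness, is
      superadditivity.\<close>
    using sublinear_add[OF q, of x y] sublinear_add[OF q, of "- x" "- y"] odd[of "x + y"]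
    by (simp add: odd)
next
  fix c :: real and x
  show "q (c *\<^sub>R x) = c *\<^sub>R q x"
  proof (cases "0 \<le> c")
    case True
    then show ?thesis using sublinear_scale[OF q] by simp
  next
    case False
    then have "q ((- c) *\<^sub>R x) = (- c) * q x" by (intro sublinear_scale[OF q]) simp
    then show ?thesis using odd[of "c *\<^sub>R x"] by simp
  qed
qed

lemma minimal_sublinear_linear:
  assumes q: "sublinear q" and min: "\<And>r. sublinear r \<Longrightarrow> r \<le> q \<Longrightarrow> r = q"
  shows "linear q"
proof (rule sublinear_odd_imp_linear[OF q])
  fix y
  have "lower_at q y = q"
    using sublinear_lower_at[OF q] lower_at_le[OF q] by (intro min) (auto simp: le_fun_def)
  then show "q (- y) = - q y"
    using lower_at_neg[OF q, of y] sublinear_neg_le[OF q, of y] by simp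
qed

text \<open>The pointwise infimum works. It is finite because
  \<open>- p (- x) <= - q (- x) <= q x\<close> for every member \<open>q\<close>, a bound that does
  not depend on \<open>q\<close>.\<close>

lemma sublinear_chain_lower_bound:
  assumes "C \<noteq> {}" and sub: "\<And>q. q \<in> C \<Longrightarrow> sublinear q \<and> q \<le> p"
    and chain: "\<And>q r. q \<in> C \<Longrightarrow> r \<in> C \<Longrightarrow> q \<le> r \<or> r \<le> q"
  obtains u where "sublinear u" "\<And>q. q \<in> C \<Longrightarrow> u \<le> q"
proof
  define u where "u x = (INF q\<in>C. q x)" for x
  have "- p (- x) \<le> q x" if "q \<in> C" for q x
  proof -
    have "q (- x) \<le> p (- x)" using sub[OF that] by (auto simp: le_fun_def)
    then show ?thesis using sublinear_neg_le[of q x] sub[OF that] by simp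
  qed
  then have "bdd_below ((\<lambda>q. q x) ` C)" for x
    by (intro bdd_belowI2[where m = "- p (- x)"])
  then have u_le: "u x \<le> q x" if "q \<in> C" for q x
    unfolding u_def using that by (rule cINF_lower)
  then show "u \<le> q" if "q \<in> C" for q
    using that by (simp add: le_fun_def)
  show "sublinear u"
    unfolding sublinear_def
  proof (intro conjI allI impI)
    fix x y
    show "u (x + y) \<le> u x + u y"
      unfolding u_def[of x] u_def[of y]
    proof (rule le_cINF_add_cINF[OF assms(1) assms(1)])
      fix q r assume qr: "q \<in> C" "r \<in> C"
      \<comment> \<open>The infima at \<open>x\<close> and \<open>y\<close> may be approached by
        different members; the smaller of the two serves at both points.\<close>
      obtain m where m: "m \<in> C" "m \<le> q" "m \<le> r" using chain[OF qr] qr by blast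
      have "u (x + y) \<le> m (x + y)" by (rule u_le[OF m(1)])
      also have "\<dots> \<le> m x + m y" using sub[OF m(1)] by (simp add: sublinear_add)
      also have "\<dots> \<le> q x + r y" using m by (simp add: le_fun_def add_mono)
      finally show "u (x + y) \<le> q x + r y" .
    qed
  next
    fix c :: real and x
    assume c: "0 \<le> c"
    show "u (c *\<^sub>R x) \<le> c * u x"
      unfolding u_def[of x]
    proof (rule le_mult_cINF[OF assms(1) c])
      fix q assume "q \<in> C"
      then show "u (c *\<^sub>R x) \<le> c * q x"
        using u_le[of q "c *\<^sub>R x"] sub[of q] sublinear_scale_le[of q c x] c by simp
    qed
  qed
qed

lemma sublinear_dominates_linear:
  assumes p: "sublinear p"
  obtains f where "linear f" "f \<le> p"
proof -
  define A where "A = {q. sublinear q \<and> q \<le> p}"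
  \<comment> \<open>Zorn's lemma supplies maximal elements, so it is applied to the reversed order;
    lower bounds of chains become upper bounds.\<close>
  have "\<exists>m\<in>A. \<forall>a\<in>A. m \<ge> a \<longrightarrow> a = m"
  proof (rule predicate_Zorn)
    show "partial_order_on A (relation_of (\<ge>) A)"
      by (rule partial_order_on_relation_ofI) auto
    fix C assume C: "C \<in> Chains (relation_of (\<ge>) A)"
    then have CA: "C \<subseteq> A" and chain: "\<And>q r. q \<in> C \<Longrightarrow> r \<in> C \<Longrightarrow> q \<le> r \<or> r \<le> q"
      by (auto simp: Chains_def relation_of_def)
    show "\<exists>u\<in>A. \<forall>a\<in>C. a \<ge> u"
    proof (cases "C = {}")
      case True
      with p show ?thesis by (auto simp: A_def)
    next
      case False
      obtain u where u: "sublinear u" "\<And>q. q \<in> C \<Longrightarrow> u \<le> q"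
        using sublinear_chain_lower_bound[OF False, of p] CA chain unfolding A_def by blast
      obtain q where q: "q \<in> C" using False by blast
      then have "u \<le> p" using u(2)[OF q] CA by (auto simp: A_def)
      with u show ?thesis by (auto simp: A_def)
    qed
  qed
  then obtain m where m: "sublinear m" "m \<le> p" and min: "\<And>r. r \<in> A \<Longrightarrow> r \<le> m \<Longrightarrow> r = m"
    by (auto simp: A_def)
  have "linear m"
  proof (rule minimal_sublinear_linear[OF m(1)])
    fix r assume "sublinear r" "r \<le> m"
    then show "r = m" using m(2) by (intro min) (auto simp: A_def)
  qed
  with m(2) that show thesis by blast
qed

theorem Hahn_Banach_sublinear:
  assumes p: "sublinear p"
  obtains f where "linear f" "f \<le> p" "f x0 = p x0"
proof -
  obtain f where f: "linear f" "f \<le> lower_at p x0"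
    using sublinear_dominates_linear[OF sublinear_lower_at[OF p]] by blast
  then have le: "f \<le> p"
    using lower_at_le[OF p] by (meson le_fun_def order_trans)
  \<comment> \<open>Domination by the lowered functional bounds \<open>f\<close> at
    \<open>- x0\<close>; linearity turns this into a lower bound at \<open>x0\<close>.\<close>
  have "f (- x0) \<le> - p x0"
    using f(2) lower_at_neg[OF p] by (meson le_fun_def order_trans)
  then have "p x0 \<le> f x0" by (simp add: linear_neg[OF f(1)])
  then have "f x0 = p x0" using le by (simp add: le_fun_def antisym)
  with f(1) le that show thesis by blast
qed

section \<open>Distance to a subspace and density of the span\<close>

lemma sublinear_infdist_subspace:
  fixes M :: "'a::real_normed_vector set"
  assumes M: "subspace M"
  shows "sublinear (\<lambda>x. infdist x M)"
proof -
  have ne: "M \<noteq> {}" using subspace_0[OF M] by blast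
  have inf: "infdist x M = (INF a\<in>M. dist x a)" for x
    using ne by (simp add: infdist_def)
  show ?thesis
    unfolding sublinear_def
  proof (intro conjI allI impI)
    fix x y
    show "infdist (x + y) M \<le> infdist x M + infdist y M"
      unfolding inf[of x] inf[of y]
    proof (rule le_cINF_add_cINF[OF ne ne])
      fix a b assume "a \<in> M" "b \<in> M"
      then have "infdist (x + y) M \<le> dist (x + y) (a + b)"
        by (intro infdist_le subspace_add[OF M])
      also have "\<dots> \<le> dist x a + dist y b" by (rule dist_triangle_add)
      finally show "infdist (x + y) M \<le> dist x a + dist y b" .
    qed
  next
    fix c :: real and x
    assume c: "0 \<le> c"
    show "infdist (c *\<^sub>R x) M \<le> c * infdist x M"
      unfolding inf[of x]
    proof (rule le_mult_cINF[OF ne c])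
      fix a assume "a \<in> M"
      then have "infdist (c *\<^sub>R x) M \<le> dist (c *\<^sub>R x) (c *\<^sub>R a)"
        by (intro infdist_le subspace_scale[OF M])
      also have "\<dots> = c * dist x a"
        using c by (simp add: dist_norm flip: scaleR_diff_right)
      finally show "infdist (c *\<^sub>R x) M \<le> c * dist x a" .
    qed
  qed
qed

text \<open>Domination by the distance gives both boundedness, since \<open>0\<close> lies in
  \<open>M\<close>, and vanishing on \<open>M\<close>, since the distance is zero at
  \<open>z\<close> and at \<open>- z\<close>. Equality at \<open>x\<close> makes the value there
  positive, as \<open>x\<close> is outside the closure.\<close>

lemma functional_separating_subspace:
  fixes M :: "'a::real_normed_vector set"
  assumes M: "subspace M" and x: "x \<notin> closure M"
  obtains \<phi> :: "'a \<Rightarrow>\<^sub>L real" where "\<And>z. z \<in> M \<Longrightarrow> blinfun_apply \<phi> z = 0" "blinfun_apply \<phi> x \<noteq> 0"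
proof -
  have ne: "M \<noteq> {}" using subspace_0[OF M] by blast
  obtain f where f: "linear f" "f \<le> (\<lambda>x. infdist x M)" "f x = infdist x M"
    using Hahn_Banach_sublinear[OF sublinear_infdist_subspace[OF M]] by blast
  have f_le: "f z \<le> infdist z M" for z using f(2) by (simp add: le_fun_def)
  have f_norm: "f z \<le> norm z" for z
    using f_le[of z] infdist_le[OF subspace_0[OF M], of z] by simp
  have "norm (f z) \<le> norm z * 1" for z
    using f_norm[of z] f_norm[of "- z"] by (simp add: linear_neg[OF f(1)] abs_le_iff)
  then have bl: "bounded_linear f"
    using f(1) by (intro bounded_linear.intro bounded_linear_axioms.intro) blast+
  have "f z = 0" if "z \<in> M" for z
    using f_le[of z] f_le[of "- z"] that subspace_neg[OF M that] by (simp add: linear_neg[OF f(1)])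
  moreover have "f x \<noteq> 0" using x in_closure_iff_infdist_zero[OF ne] f(3) by simp
  ultimately show thesis
    using that[of "Blinfun f"] by (simp add: bounded_linear_Blinfun_apply[OF bl])
qed

theorem mainTheorem4:
  fixes K :: "'a::banach set"
  assumes "norming_set K"
  shows "closure (span K) = UNIV"
proof (rule ccontr)
  assume "closure (span K) \<noteq> UNIV"
  then obtain x where "x \<notin> closure (span K)" by blast
  then obtain \<phi> :: "'a \<Rightarrow>\<^sub>L real"
    where zero: "\<And>z. z \<in> span K \<Longrightarrow> blinfun_apply \<phi> z = 0" and nz: "blinfun_apply \<phi> x \<noteq> 0"
    using functional_separating_subspace[OF subspace_span] by blast
  obtain C where "ennreal (norm \<phi>) \<le> ennreal C * (SUP z\<in>K. ennreal \<bar>blinfun_apply \<phi> z\<bar>)"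
    using assms unfolding norming_set_def by blast
  \<comment> \<open>For empty \<open>K\<close> the supremum is the bottom element of
    \<open>ennreal\<close>, which is \<open>0\<close>; otherwise every term is
    \<open>0\<close>.\<close>
  moreover have "(SUP z\<in>K. ennreal \<bar>blinfun_apply \<phi> z\<bar>) = 0"
    using zero[OF span_base] by (cases "K = {}") (simp_all add: bot_ennreal)
  ultimately have "\<phi> = 0" by simp
  with nz show False by simp
qed

end
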